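(* Let $T$ be a tree of order $n \geq 3$ with $l$ leaves. Then $\gamma(T) = n - l$ if and only if every vertex of $T$ is either a leaf or a support vertex.
   Context: A leaf is a vertex of degree one; its unique neighbor is called a support vertex. A set $D \subseteq V(T)$ is a dominating set if every vertex not in $D$ is adjacent to a vertex of $D$; $\gamma(T)$ is the minimum cardinality of a dominating set of $T$. *)

theory Defs
  imports "Graph_Theory.Digraph_Component"
begin

text \<open>
  A finite simple undirected graph is a symmetric digraph, \<^locale>\<open>graph\<close>: each edge is a pair of
  opposite arcs.  Hence \<^const>\<open>out_degree\<close> is the degree of a vertex.  The library predicate
  \<^const>\<open>tree\<close> is not the notion of a tree for such graphs: the two arcs of an edge form a directed
  cycle of length 2, so it excludes every edge.  The cycles of the underlying undirected graph are
  the directed cycles of length at least 3.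
\<close>

locale undirected_tree = graph +
  assumes tree_connected: "connected G"
    and tree_acyclic: "\<not> (\<exists>p. cycle p \<and> 3 \<le> length p)"

definition leaf :: "('a, 'b) pre_digraph \<Rightarrow> 'a \<Rightarrow> bool" where
  "leaf G v \<longleftrightarrow> v \<in> verts G \<and> out_degree G v = 1"

definition support_vertex :: "('a, 'b) pre_digraph \<Rightarrow> 'a \<Rightarrow> bool" where
  "support_vertex G v \<longleftrightarrow> (\<exists>u. leaf G u \<and> u \<rightarrow>\<^bsub>G\<^esub> v)"

text \<open>The library abbreviation \<open>dominates\<close>, written with an arrow, is plain adjacency.\<close>

definition dominating_set :: "('a, 'b) pre_digraph \<Rightarrow> 'a set \<Rightarrow> bool" where
  "dominating_set G D \<longleftrightarrow> D \<subseteq> verts G \<and> (\<forall>v \<in> verts G - D. \<exists>u \<in> D. v \<rightarrow>\<^bsub>G\<^esub> u)"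

definition domination_number :: "('a, 'b) pre_digraph \<Rightarrow> nat" where
  "domination_number G = Min (card ` {D. dominating_set G D})"

end

theory Submission
  imports Defs
begin

text \<open>
  Deleting all leaves from the vertex set leaves a dominating set, so the domination number is at
  most \<open>n - l\<close>.  A vertex that is neither a leaf nor a support vertex can be deleted as well, since
  all its neighbours are non-leaves and it is the neighbour of no leaf; hence equality forces every
  vertex to be a leaf or a support vertex.  Conversely, a dominating set contains each support
  vertex or one of its leaves, and distinct support vertices have distinct leaves, so its cardinality
  is at least the number of support vertices.
\<close>

context graph
begin

lemma adj_sym: "u \<rightarrow> v \<Longrightarrow> v \<rightarrow> u"
  using arcs_ends_symmetric[OF sym_arcs] .

lemma leaf_adj_unique:
  assumes "leaf G u" "u \<rightarrow> v" "u \<rightarrow> w"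
  shows "v = w"
proof -
  obtain a where "out_arcs G u = {a}"
    using assms(1) by (auto simp: leaf_def out_degree_def card_1_singleton_iff)
  moreover obtain e f where "e \<in> out_arcs G u" "head G e = v" "f \<in> out_arcs G u" "head G f = w"
    using assms(2,3) by (auto simp: arcs_ends_conv)
  ultimately show ?thesis by auto
qed

text \<open>Leaves are vertices by definition, so the truncated subtraction is a true difference;
  the main argument can then count non-leaves and avoid subtraction.\<close>

lemma card_non_leaves: "card {v \<in> verts G. \<not> leaf G v} = card (verts G) - card {v. leaf G v}"
proof -
  have sub: "{v. leaf G v} \<subseteq> verts G"
    by (auto simp: leaf_def)
  have "{v \<in> verts G. \<not> leaf G v} = verts G - {v. leaf G v}"
    by auto
  with sub show ?thesis
    by (simp add: card_Diff_subset finite_subset[OF sub])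
qed

lemma finite_dominating_sets: "finite {D. dominating_set G D}"
  by (rule finite_subset[of _ "Pow (verts G)"]) (auto simp: dominating_set_def)

lemma domination_number_le: "dominating_set G D \<Longrightarrow> domination_number G \<le> card D"
  unfolding domination_number_def using finite_dominating_sets by (intro Min_le) auto

lemma le_domination_number:
  assumes "\<And>D. dominating_set G D \<Longrightarrow> k \<le> card D"
  shows "k \<le> domination_number G"
proof -
  \<comment> \<open>\<open>Min\<close> is meaningful only on a nonempty set; the full vertex set
    supplies a member.\<close>
  have "dominating_set G (verts G)"
    by (simp add: dominating_set_def)
  then show ?thesis
    unfolding domination_number_def using finite_dominating_sets assms
    by (subst Min_ge_iff) auto
qed

lemma card_support_vertices_le:
  assumes D: "dominating_set G D"
    and S: "\<And>v. v \<in> S \<Longrightarrow> support_vertex G v" "\<And>v. v \<in> S \<Longrightarrow> \<not> leaf G v"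
  shows "card S \<le> card D"
proof -
  have "\<exists>d \<in> D. d = v \<or> (leaf G d \<and> d \<rightarrow> v)" if v: "v \<in> S" for v
  proof -
    obtain u where u: "leaf G u" "u \<rightarrow> v"
      using S(1)[OF v] by (auto simp: support_vertex_def)
    show ?thesis
    proof (cases "u \<in> D")
      case False
      \<comment> \<open>The vertex that dominates \<open>u\<close> can only be \<open>v\<close>, the
        sole neighbour of the leaf \<open>u\<close>.\<close>
      then obtain w where "w \<in> D" "u \<rightarrow> w"
        using D adj_in_verts(1)[OF u(2)] by (auto simp: dominating_set_def)
      then show ?thesis
        using leaf_adj_unique[OF u(1)] u(2) by blast
    qed (use u in blast)
  qed
  then obtain f where f: "\<And>v. v \<in> S \<Longrightarrow> f v \<in> D \<and> (f v = v \<or> leaf G (f v) \<and> f v \<rightarrow> v)"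
    by metis
  show ?thesis
  proof (rule card_inj_on_le)
    show "inj_on f S"
    proof (rule inj_onI)
      fix v w assume "v \<in> S" "w \<in> S" "f v = f w"
      then show "v = w"
        \<comment> \<open>If \<open>f v\<close> is a leaf adjacent to both \<open>v\<close> and
          \<open>w\<close>, they coincide by uniqueness of its neighbour. In the mixed case
          \<open>v\<close> or \<open>w\<close> would itself be a leaf, against
          \<open>S(2)\<close>.\<close>
        using f[of v] f[of w] S(2) leaf_adj_unique[of "f v" v w] by metis
    qed
    show "f ` S \<subseteq> D"
      using f by blast
    show "finite D"
      using D finite_subset[OF _ finite_verts] by (auto simp: dominating_set_def)
  qed
qed

text \<open>Serves to bound the order of the graph: it is applied to \<open>{v}\<close> for an
  isolated vertex and to \<open>{u, v}\<close> for two adjacent leaves.\<close>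

lemma connected_closed_subset:
  assumes "connected G" "x \<in> S" "x \<in> verts G"
    and closed: "\<And>u v. u \<in> S \<Longrightarrow> u \<rightarrow> v \<Longrightarrow> v \<in> S"
  shows "verts G \<subseteq> S"
proof
  fix y assume "y \<in> verts G"
  \<comment> \<open>Connectivity refers to the symmetric closure; as the arcs are already symmetric,
    it yields directed reachability.\<close>
  then have "x \<rightarrow>\<^sup>* y"
    using symmetric_connected_imp_strongly_connected[OF sym_arcs assms(1)] assms(3)
    by (auto simp: strongly_connected_def)
  then show "y \<in> S"
    by (induction rule: reachable_induct) (use assms(2) closed in auto)
qed

lemma connected_ex_adj:
  assumes "connected G" "card (verts G) \<ge> 2" "v \<in> verts G"
  obtains w where "v \<rightarrow> w"
proof (cases "\<exists>w. v \<rightarrow> w")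
  case False
  then have "verts G \<subseteq> {v}"
    using connected_closed_subset[OF assms(1), of v "{v}"] assms(3) by blast
  then have "card (verts G) \<le> 1"
    using card_mono[of "{v}" "verts G"] by simp
  with assms(2) show ?thesis by simp
qed (use that in blast)

text \<open>Two adjacent leaves have no neighbours but each other, so they would be the whole
  graph.\<close>

lemma connected_leaves_not_adj:
  assumes "connected G" "card (verts G) \<ge> 3" "leaf G u" "u \<rightarrow> v"
  shows "\<not> leaf G v"
proof
  assume v: "leaf G v"
  have "verts G \<subseteq> {u, v}"
  proof (rule connected_closed_subset[OF assms(1)])
    show "u \<in> verts G"
      using assms(3) by (simp add: leaf_def)
    show "y \<in> {u, v}" if "x \<in> {u, v}" "x \<rightarrow> y" for x y
      using that leaf_adj_unique[OF assms(3,4)] leaf_adj_unique[OF v adj_sym[OF assms(4)]] by blast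
  qed simp
  then have "card (verts G) \<le> card {u, v}"
    by (intro card_mono) auto
  also have "\<dots> \<le> 2"
    by (simp add: card_insert_if)
  finally show False
    using assms(2) by simp
qed

text \<open>A leaf is dominated by its neighbour, which is a support vertex and so neither a leaf
  nor in \<open>X\<close>. A vertex of \<open>X\<close> has a neighbour, which is no leaf since
  \<open>X\<close> avoids support vertices, and lies outside \<open>X\<close> by independence. The
  cases \<open>X = {}\<close> and \<open>X = {v}\<close> serve the two directions of the
  equivalence.\<close>

lemma dominating_set_remove_non_support:
  assumes con: "connected G" and n: "card (verts G) \<ge> 3"
    and X: "\<And>x. x \<in> X \<Longrightarrow> \<not> support_vertex G x" "\<And>x y. x \<in> X \<Longrightarrow> y \<in> X \<Longrightarrow> \<not> x \<rightarrow> y"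
  shows "dominating_set G ({v \<in> verts G. \<not> leaf G v} - X)"
  unfolding dominating_set_def
proof (intro conjI ballI)
  fix v assume v: "v \<in> verts G - ({v \<in> verts G. \<not> leaf G v} - X)"
  obtain w where w: "v \<rightarrow> w"
    using connected_ex_adj[OF con _, of v] n v by auto
  have "w \<in> verts G"
    using adj_in_verts(2)[OF w] .
  moreover have "\<not> leaf G w \<and> w \<notin> X"
  proof (cases "leaf G v")
    case True
    then show ?thesis
      using connected_leaves_not_adj[OF con n True w] X(1) w by (auto simp: support_vertex_def)
  next
    case False
    then have "v \<in> X"
      using v by auto
    then show ?thesis
      using X adj_sym[OF w] w by (auto simp: support_vertex_def)
  qed
  ultimately show "\<exists>u \<in> {v \<in> verts G. \<not> leaf G v} - X. v \<rightarrow> u"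
    using w by auto
qed auto

theorem connected_domination_number_eq_card_non_leaves_iff:
  assumes con: "connected G" and n: "card (verts G) \<ge> 3"
  shows "domination_number G = card {v \<in> verts G. \<not> leaf G v} \<longleftrightarrow>
    (\<forall>v \<in> verts G. leaf G v \<or> support_vertex G v)"
    (is "_ = card ?N \<longleftrightarrow> _")
proof (intro iffI ballI)
  fix v assume eq: "domination_number G = card ?N" and v: "v \<in> verts G"
  show "leaf G v \<or> support_vertex G v"
  proof (rule ccontr)
    assume neither: "\<not> (leaf G v \<or> support_vertex G v)"
    then have "dominating_set G (?N - {v})"
      \<comment> \<open>Independence of \<open>{v}\<close> is the absence of loops.\<close>
      using adj_not_same by (intro dominating_set_remove_non_support[OF con n]) auto
    then have "card ?N \<le> card (?N - {v})"
      using domination_number_le eq by metis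
    moreover have "card (?N - {v}) < card ?N"
      using neither v by (intro card_Diff1_less) auto
    ultimately show False by simp
  qed
next
  assume "\<forall>v \<in> verts G. leaf G v \<or> support_vertex G v"
  \<comment> \<open>Here \<open>S\<close> is the set of all non-leaves, which are support vertices
    by assumption.\<close>
  then have "card ?N \<le> domination_number G"
    by (intro le_domination_number card_support_vertices_le) auto
  moreover have "domination_number G \<le> card ?N"
    using domination_number_le dominating_set_remove_non_support[OF con n, of "{}"] by simp
  ultimately show "domination_number G = card ?N" by simp
qed

end

theorem theorem3p1:
  fixes T :: "('a, 'b) pre_digraph" and n l :: nat
  assumes "undirected_tree T"
    and "card (verts T) = n" and "n \<ge> 3"
    and "card {v. leaf T v} = l"
  shows "domination_number T = n - l \<longleftrightarrow>
    (\<forall>v \<in> verts T. leaf T v \<or> support_vertex T v)"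
proof -
  interpret undirected_tree T by fact
  show ?thesis
    using connected_domination_number_eq_card_non_leaves_iff[OF tree_connected]
      card_non_leaves assms(2-4) by simp
qed

end
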